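(* Let $G_1$ and $G_2$ be two disjoint graphs on $m\geq 1$ and $n\geq 1$ vertices, respectively, such that the join $G_1+G_2$ is not complete. Suppose $G_1$ is an $r$-regular graph. Then $$\mathrm{QEC}(G_1+G_2)=-2-\min\left(\bigcup_{i=1}^4\big(\Lambda_i\cap(-\infty,-1)\big)\right),$$ where \begin{align*} \Lambda_1&:=\{r-m\}\cap\big(\sigma(A_{G_1})\cup\sigma(A_{G_2}-J)\big),\\ \Lambda_2&:=\{r-2m\}\cap\sigma(A_{G_2}),\\ \Lambda_3&:=\big(\sigma_0(A_{G_1})\cup\sigma_0(A_{G_2})\big)\setminus\{r-m,\,r-2m\},\\ \Lambda_4&:=\big\{\lambda\in\mathbb{R}\setminus\big(\{r-m,r-2m\}\cup\sigma(A_{G_1})\cup\sigma(A_{G_2})\big):\ m=(\lambda+2m-r)\,\langle e,(A_{G_2}-\lambda I)^{-1}e\rangle\big\}. \end{align*}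
   Context: All graphs are finite, simple and unweighted (undirected). For a graph $G$, $A_G$ is its adjacency matrix. For a connected graph $G=(V,E)$, $D_G$ is its distance matrix (entries are shortest-path distances), and the quadratic embedding constant is $\mathrm{QEC}(G):=\max\{\langle f,D_Gf\rangle : f\in\mathbb{R}^{V},\ \langle f,f\rangle=1,\ \langle e,f\rangle=0\}$. Here $e$ is the all-ones vector, $J$ the all-ones matrix and $I$ the identity matrix of the appropriate size, and $\langle\cdot,\cdot\rangle$ is the standard inner product. For a square matrix $M$, $\sigma(M)$ is the set of eigenvalues of $M$, and $\sigma_0(M)$ is the set of $\lambda\in\sigma(M)$ having an associated eigenvector $x$ with $\langle e,x\rangle=0$. The join $G_1+G_2$ of two disjoint graphs $G_1=(V_1,E_1)$, $G_2=(V_2,E_2)$ ($V_1\cap V_2=\emptyset$) has vertex set $V_1\cup V_2$ and edge set $E_1\cup E_2$ together with all edges joining a vertex of $V_1$ to a vertex of $V_2$. *)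

theory Defs
  imports "HOL-Analysis.Analysis"
begin

text \<open>
  A graph is given by its adjacency relation on a finite type, which serves as the vertex set;
  thus a graph with vertex type \<open>'a\<close> has \<open>CARD('a) \<ge> 1\<close> vertices.
  Graphs on \<open>'a\<close> and \<open>'b\<close> become disjoint inside the sum type \<open>'a + 'b\<close>.
\<close>

definition simple_graph :: "('a \<Rightarrow> 'a \<Rightarrow> bool) \<Rightarrow> bool" where
  "simple_graph E \<longleftrightarrow> symp E \<and> irreflp E"

definition complete_graph :: "('a \<Rightarrow> 'a \<Rightarrow> bool) \<Rightarrow> bool" where
  "complete_graph E \<longleftrightarrow> (\<forall>u v. u \<noteq> v \<longrightarrow> E u v)"

definition regular_graph :: "('a::finite \<Rightarrow> 'a \<Rightarrow> bool) \<Rightarrow> nat \<Rightarrow> bool" where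
  "regular_graph E r \<longleftrightarrow> (\<forall>u. card {v. E u v} = r)"

fun graph_join :: "('a \<Rightarrow> 'a \<Rightarrow> bool) \<Rightarrow> ('b \<Rightarrow> 'b \<Rightarrow> bool) \<Rightarrow> 'a + 'b \<Rightarrow> 'a + 'b \<Rightarrow> bool" where
  "graph_join E1 E2 (Inl u) (Inl v) = E1 u v"
| "graph_join E1 E2 (Inr u) (Inr v) = E2 u v"
| "graph_join E1 E2 (Inl u) (Inr v) = True"
| "graph_join E1 E2 (Inr u) (Inl v) = True"

text \<open>
  \<open>(E ^^ k) u v\<close> says that there is a walk of length \<open>k\<close> from \<open>u\<close> to \<open>v\<close>; a shortest walk is
  a shortest path. The value is only meaningful if \<open>u\<close> and \<open>v\<close> are connected.
\<close>

definition graph_dist :: "('a \<Rightarrow> 'a \<Rightarrow> bool) \<Rightarrow> 'a \<Rightarrow> 'a \<Rightarrow> nat" where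
  "graph_dist E u v = (LEAST k. (E ^^ k) u v)"

definition adj_mat :: "('a::finite \<Rightarrow> 'a \<Rightarrow> bool) \<Rightarrow> real ^ 'a ^ 'a" where
  "adj_mat E = (\<chi> u v. if E u v then 1 else 0)"

definition dist_mat :: "('a::finite \<Rightarrow> 'a \<Rightarrow> bool) \<Rightarrow> real ^ 'a ^ 'a" where
  "dist_mat E = (\<chi> u v. real (graph_dist E u v))"

definition ones_vec :: "real ^ 'a" where
  "ones_vec = (\<chi> u. 1)"

definition ones_mat :: "real ^ 'a ^ 'a" where
  "ones_mat = (\<chi> u v. 1)"

text \<open>Only used for connected graphs with at least two vertices; the maximum is then attained
  (see \<open>QEC_is_max\<close>).\<close>

definition QEC :: "('a::finite \<Rightarrow> 'a \<Rightarrow> bool) \<Rightarrow> real" where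
  "QEC E = (GREATEST q. q \<in> {f \<bullet> (dist_mat E *v f) | f. f \<bullet> f = 1 \<and> ones_vec \<bullet> f = 0})"

text \<open>Real eigenvalues with real eigenvectors; this is the full spectrum for the symmetric
  matrices considered here.\<close>

definition spec :: "real ^ 'a ^ 'a \<Rightarrow> real set" where
  "spec M = {l. \<exists>x. x \<noteq> 0 \<and> M *v x = l *\<^sub>R x}"

definition spec0 :: "real ^ 'a ^ 'a \<Rightarrow> real set" where
  "spec0 M = {l \<in> spec M. \<exists>x. x \<noteq> 0 \<and> M *v x = l *\<^sub>R x \<and> ones_vec \<bullet> x = 0}"

lemma QEC_is_max:
  fixes E :: "'a::finite \<Rightarrow> 'a \<Rightarrow> bool"
  assumes "CARD('a) \<ge> 2"
  defines "S \<equiv> {f \<bullet> (dist_mat E *v f) | f. f \<bullet> f = 1 \<and> ones_vec \<bullet> f = 0}"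
  shows "QEC E \<in> S" and "\<And>q. q \<in> S \<Longrightarrow> q \<le> QEC E"
proof -
  let ?K = "{f :: real ^ 'a. f \<bullet> f = 1 \<and> ones_vec \<bullet> f = 0}"
  have S: "S = (\<lambda>f. f \<bullet> (dist_mat E *v f)) ` ?K"
    unfolding S_def by auto
  have "?K = sphere 0 1 \<inter> {f. ones_vec \<bullet> f = 0}"
    by (auto simp: norm_eq_1)
  then have "compact ?K"
    by (simp only: compact_Int_closed compact_sphere closed_hyperplane)
  moreover have "continuous_on ?K (\<lambda>f. f \<bullet> (dist_mat E *v f))"
    by (intro continuous_on_inner continuous_on_id matrix_vector_mult_linear_continuous_on)
  ultimately have "compact S"
    unfolding S by (rule compact_continuous_image[rotated])
  obtain a b :: 'a where "a \<noteq> b"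
    using assms(1) card_le_Suc0_iff_eq[of "UNIV :: 'a set"] by fastforce
  define g :: "real ^ 'a" where "g = axis a 1 - axis b 1"
  have "g \<noteq> 0"
    using \<open>a \<noteq> b\<close> by (auto simp: g_def axis_eq_axis)
  moreover have "ones_vec \<bullet> g = 0"
    by (simp add: g_def inner_diff_right inner_axis ones_vec_def)
  ultimately have "g /\<^sub>R norm g \<in> ?K"
    by (simp add: dot_square_norm power2_eq_square)
  then have "S \<noteq> {}"
    unfolding S by blast
  then obtain q where q: "q \<in> S" "\<forall>p\<in>S. p \<le> q"
    using compact_attains_sup[OF \<open>compact S\<close>] by blast
  then have "QEC E = q"
    unfolding QEC_def S_def[symmetric] by (intro Greatest_equality) auto
  with q show "QEC E \<in> S" and "\<And>q. q \<in> S \<Longrightarrow> q \<le> QEC E"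
    by auto
qed

end

theory Submission
  imports Defs
begin

text \<open>
  Write \<open>e\<close> for the all-ones vector, \<open>A\<close> for the adjacency matrix of the join and \<open>A\<^sub>1\<close>, \<open>A\<^sub>2\<close> for
  those of the two graphs, on \<open>m\<close> and \<open>n\<close> vertices. Any two non-adjacent vertices of a join have
  a common neighbour, so the distance matrix is \<open>2J - 2I - A\<close>. On the hyperplane orthogonal
  to \<open>e\<close> the matrix \<open>J\<close> contributes nothing, and hence \<open>QEC = -2 - \<mu>\<close>, where \<open>\<mu>\<close> is the
  minimum of the Rayleigh quotient of \<open>A\<close> on that hyperplane. By Lagrange multipliers \<open>\<mu>\<close> is the least
  number \<open>\<lambda>\<close> for which \<open>A f = \<lambda> f + \<nu> e\<close> has a solution \<open>f \<noteq> 0\<close> orthogonal to \<open>e\<close>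
  (\<open>QEC_diameter_two\<close>). A join that is not complete contains an induced path on three vertices,
  which gives \<open>\<mu> < -1\<close> (\<open>induced_path_rayleigh\<close>).

  It remains to find these numbers \<open>\<lambda>\<close>. Split \<open>f\<close> into \<open>x\<close> and \<open>y\<close>, so that
  \<open>\<langle>e, x\<rangle> = - \<langle>e, y\<rangle>\<close>. Regularity of the first graph makes \<open>e\<close> an eigenvector of \<open>A\<^sub>1\<close>; pairing the
  first block of the equation with \<open>e\<close> therefore expresses \<open>\<nu>\<close> through \<open>\<langle>e, y\<rangle>\<close>, and
  the system decouples (\<open>compressed_spec_join\<close>): either \<open>\<lambda> \<in> \<sigma>\<^sub>0(A\<^sub>1)\<close>, or \<open>\<lambda>\<close> is an eigenvalue of
  \<open>A\<^sub>2 - c J\<close> with \<open>c = (\<lambda> + 2m - r) / m\<close>. The sets of the theorem are the cases of this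
  dichotomy: \<open>c = 1\<close> for \<open>\<lambda> = r - m\<close>, \<open>c = 0\<close> for \<open>\<lambda> = r - 2m\<close>, and otherwise the
  eigenvalues of a rank-one perturbation of \<open>A\<^sub>2\<close>, which are governed by the secular equation
  \<open>c \<langle>e, (A\<^sub>2 - \<lambda> I)\<^sup>-\<^sup>1 e\<rangle> = 1\<close> (\<open>spec_rank_one_perturbation\<close>). The bound \<open>\<bar>\<lambda>\<bar> \<le> r < m\<close> for the
  eigenvalues of \<open>A\<^sub>1\<close> explains why \<open>\<sigma>\<^sub>0(A\<^sub>1)\<close> is absent from the case \<open>\<lambda> = r - 2m\<close>.
\<close>

section \<open>Minimising a quadratic form on the hyperplane orthogonal to the ones vector\<close>

text \<open>
  For symmetric \<open>M\<close> these are the stationary values of the Rayleigh quotient on the hyperplane, with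
  \<open>\<nu>\<close> as Lagrange multiplier; equivalently, the eigenvalues of the compression of \<open>M\<close> to the
  hyperplane.
\<close>

definition compressed_spec :: "real ^ 'a ^ 'a \<Rightarrow> real set" where
  "compressed_spec M =
     {l. \<exists>f \<nu>. f \<noteq> 0 \<and> ones_vec \<bullet> f = 0 \<and> M *v f = l *\<^sub>R f + \<nu> *\<^sub>R ones_vec}"

lemma spec0_iff:
  "l \<in> spec0 M \<longleftrightarrow> (\<exists>x. x \<noteq> 0 \<and> M *v x = l *\<^sub>R x \<and> ones_vec \<bullet> x = 0)"
  by (auto simp: spec0_def spec_def)

lemma ones_mat_vector: "ones_mat *v (x :: real ^ 'n::finite) = (ones_vec \<bullet> x) *\<^sub>R ones_vec"
  by (simp add: vec_eq_iff matrix_vector_mult_def ones_mat_def ones_vec_def inner_vec_def)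

lemma inner_ones_ones: "(ones_vec :: real ^ 'n::finite) \<bullet> ones_vec = real CARD('n)"
  by (simp add: inner_vec_def ones_vec_def)

lemma inner_symmetric_matrix:
  fixes M :: "real ^ 'n::finite ^ 'n"
  assumes "transpose M = M"
  shows "x \<bullet> (M *v y) = (M *v x) \<bullet> y"
  by (metis assms dot_lmul_matrix transpose_matrix_vector)

text \<open>
  Perturbing the minimiser \<open>f\<close> inside the hyperplane shows that the residual \<open>M f - l f\<close> is
  orthogonal to the hyperplane, hence a multiple of the ones vector.
\<close>

lemma rayleigh_minimizer_stationary:
  fixes M :: "real ^ 'n::finite ^ 'n"
  assumes sym: "transpose M = M"
    and f: "f \<bullet> f = 1" "ones_vec \<bullet> f = 0" "f \<bullet> (M *v f) = l"
    and min: "\<And>g. ones_vec \<bullet> g = 0 \<Longrightarrow> l * (g \<bullet> g) \<le> g \<bullet> (M *v g)"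
  shows "l \<in> compressed_spec M"
proof -
  define h where "h = M *v f - l *\<^sub>R f"
  have orth: "g \<bullet> h = 0" if g: "ones_vec \<bullet> g = 0" for g
  proof (rule ccontr)
    assume neq: "g \<bullet> h \<noteq> 0"
    define a where "a = g \<bullet> h"
    define b where "b = g \<bullet> (M *v g) - l * (g \<bullet> g)"
    have b: "0 \<le> b"
      using min[OF g] by (simp add: b_def)
    have quad: "0 \<le> 2 * t * a + t\<^sup>2 * b" for t
    proof -
      have "ones_vec \<bullet> (f + t *\<^sub>R g) = 0"
        using f g by (simp add: inner_add_right)
      from min[OF this] show ?thesis
        using f inner_symmetric_matrix[OF sym, of f g]
        by (simp add: a_def b_def h_def algebra_simps inner_add inner_diff power2_eq_square
            matrix_vector_right_distrib matrix_vector_mult_scaleR inner_commute)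
    qed
    \<comment> \<open>The quadratic takes a negative value at \<open>- a / (b + 1)\<close>; the summand 1 keeps the
       denominator positive when \<open>b = 0\<close>.\<close>
    have "2 * (- a / (b + 1)) * a + (- a / (b + 1))\<^sup>2 * b = - (a\<^sup>2 * (b + 2)) / (b + 1)\<^sup>2"
      using b by (simp add: divide_simps power2_eq_square) (simp add: algebra_simps)
    moreover have "0 < a\<^sup>2 * (b + 2) / (b + 1)\<^sup>2"
      using b neq by (simp add: a_def)
    ultimately show False
      using quad[of "- a / (b + 1)"] by simp
  qed
  \<comment> \<open>The projection of the residual to the hyperplane is orthogonal to itself.\<close>
  define \<nu> where "\<nu> = (ones_vec \<bullet> h) / real CARD('n)"
  define g where "g = h - \<nu> *\<^sub>R ones_vec"
  have g: "ones_vec \<bullet> g = 0"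
    by (simp add: g_def \<nu>_def inner_diff_right inner_ones_ones)
  then have "g \<bullet> g = 0"
    using orth[OF g] by (simp add: g_def inner_diff_right inner_commute)
  then have "g = 0"
    by (simp only: inner_eq_zero_iff)
  then have "M *v f = l *\<^sub>R f + \<nu> *\<^sub>R ones_vec"
    by (simp add: g_def h_def algebra_simps)
  moreover have "f \<noteq> 0"
    using f(1) by auto
  ultimately show ?thesis
    using f(2) by (auto simp: compressed_spec_def)
qed

section \<open>The quadratic embedding constant when all distances are at most two\<close>

text \<open>
  The all-ones matrix vanishes as a quadratic form on the hyperplane, so maximising the distance form
  there is the same as minimising the adjacency form. Any other stationary value is the Rayleigh quotient
  of its own vector and therefore no smaller than the minimum.
\<close>

lemma QEC_diameter_two:
  fixes E :: "'n::finite \<Rightarrow> 'n \<Rightarrow> bool"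
  assumes card: "CARD('n) \<ge> 2" and sym: "transpose (adj_mat E) = adj_mat E"
    and dist: "dist_mat E = 2 *\<^sub>R ones_mat - 2 *\<^sub>R mat 1 - adj_mat E"
  shows "- 2 - QEC E \<in> compressed_spec (adj_mat E)"
    and "\<And>g. ones_vec \<bullet> g = 0 \<Longrightarrow> (- 2 - QEC E) * (g \<bullet> g) \<le> g \<bullet> (adj_mat E *v g)"
    and "\<And>l. l \<in> compressed_spec (adj_mat E) \<Longrightarrow> - 2 - QEC E \<le> l"
proof -
  have form: "f \<bullet> (dist_mat E *v f) = - 2 * (f \<bullet> f) - f \<bullet> (adj_mat E *v f)"
    if "ones_vec \<bullet> f = 0" for f
    using that by (simp add: dist matrix_vector_mult_diff_rdistrib scaleR_matrix_vector_assoc[symmetric]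
        ones_mat_vector inner_diff_right)
  show min: "(- 2 - QEC E) * (g \<bullet> g) \<le> g \<bullet> (adj_mat E *v g)" if g: "ones_vec \<bullet> g = 0" for g
  proof (cases "g = 0")
    case False
    define u where "u = g /\<^sub>R norm g"
    have u: "u \<bullet> u = 1" "ones_vec \<bullet> u = 0"
      using False g by (simp_all add: u_def dot_square_norm power2_eq_square)
    then have "u \<bullet> (dist_mat E *v u) \<le> QEC E"
      by (intro QEC_is_max(2)[OF card]) auto
    then have "- 2 - QEC E \<le> u \<bullet> (adj_mat E *v u)"
      using form[of u] u by simp
    also have "\<dots> = (g \<bullet> (adj_mat E *v g)) / (g \<bullet> g)"
      using False
      by (simp add: u_def matrix_vector_mult_scaleR dot_square_norm power2_eq_square divide_simps)
    finally show ?thesis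
      using False by (simp add: pos_le_divide_eq)
  qed simp
  obtain f where f: "QEC E = f \<bullet> (dist_mat E *v f)" "f \<bullet> f = 1" "ones_vec \<bullet> f = 0"
    using QEC_is_max(1)[OF card, of E] by auto
  show "- 2 - QEC E \<in> compressed_spec (adj_mat E)"
    using f form[of f] min by (intro rayleigh_minimizer_stationary[OF sym, of f]) auto
  show "- 2 - QEC E \<le> l" if l: "l \<in> compressed_spec (adj_mat E)" for l
  proof -
    obtain f \<nu> where f: "f \<noteq> 0" "ones_vec \<bullet> f = 0"
        and "adj_mat E *v f = l *\<^sub>R f + \<nu> *\<^sub>R ones_vec"
      using l by (auto simp: compressed_spec_def)
    then have "f \<bullet> (adj_mat E *v f) = l * (f \<bullet> f)"
      by (simp add: inner_add_right inner_commute)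
    then show ?thesis
      using min[OF f(2)] f(1) by simp
  qed
qed

section \<open>Eigenvalues of a rank-one perturbation\<close>

text \<open>
  An eigenvector \<open>y\<close> of the perturbed matrix satisfies \<open>(M - l I) y = c \<langle>e, y\<rangle> e\<close>. If
  \<open>\<langle>e, y\<rangle> = 0\<close>, it is an eigenvector of \<open>M\<close> itself. Otherwise \<open>e\<close> lies in the range of
  \<open>M - l I\<close>, so by symmetry every eigenvector of \<open>M\<close> for \<open>l\<close> is orthogonal to \<open>e\<close>; and if
  there is none, solving for \<open>y\<close> and pairing with \<open>e\<close> gives the secular equation.
\<close>

lemma spec_rank_one_perturbation:
  fixes M :: "real ^ 'n::finite ^ 'n"
  assumes sym: "transpose M = M" and c: "c \<noteq> 0"
  shows "l \<in> spec (M - c *\<^sub>R ones_mat) \<longleftrightarrow>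
           l \<in> spec0 M \<or>
           (l \<notin> spec M \<and> c * (ones_vec \<bullet> (matrix_inv (M - l *\<^sub>R mat 1) *v ones_vec)) = 1)"
proof -
  define R where "R = matrix_inv (M - l *\<^sub>R mat 1)"
  have perturbed: "l \<in> spec (M - c *\<^sub>R ones_mat) \<longleftrightarrow>
      (\<exists>y. y \<noteq> 0 \<and> M *v y - l *\<^sub>R y = (c * (ones_vec \<bullet> y)) *\<^sub>R ones_vec)"
    by (simp add: spec_def matrix_vector_mult_diff_rdistrib
        scaleR_matrix_vector_assoc[symmetric] ones_mat_vector algebra_simps)
  have shift: "(M - l *\<^sub>R mat 1) *v y = M *v y - l *\<^sub>R y" for y
    by (simp add: matrix_vector_mult_diff_rdistrib scaleR_matrix_vector_assoc[symmetric])
  have R: "R ** (M - l *\<^sub>R mat 1) = mat 1" "(M - l *\<^sub>R mat 1) ** R = mat 1" if "l \<notin> spec M"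
  proof -
    have "\<exists>B. B ** (M - l *\<^sub>R mat 1) = mat 1"
      unfolding matrix_left_invertible_ker shift using that by (auto simp: spec_def)
    then have "invertible (M - l *\<^sub>R mat 1)"
      by (simp add: invertible_left_inverse)
    then have "(M - l *\<^sub>R mat 1) ** R = mat 1 \<and> R ** (M - l *\<^sub>R mat 1) = mat 1"
      unfolding R_def matrix_inv_def invertible_def by (rule someI_ex)
    then show "R ** (M - l *\<^sub>R mat 1) = mat 1" "(M - l *\<^sub>R mat 1) ** R = mat 1"
      by auto
  qed
  show ?thesis
    unfolding R_def[symmetric]
  proof
    assume "l \<in> spec (M - c *\<^sub>R ones_mat)"
    then obtain y where y: "y \<noteq> 0" "M *v y - l *\<^sub>R y = (c * (ones_vec \<bullet> y)) *\<^sub>R ones_vec"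
      by (auto simp: perturbed)
    show "l \<in> spec0 M \<or> (l \<notin> spec M \<and> c * (ones_vec \<bullet> (R *v ones_vec)) = 1)"
    proof (cases "ones_vec \<bullet> y = 0")
      case True
      then show ?thesis
        using y by (auto simp: spec0_iff)
    next
      case False
      show ?thesis
      proof (cases "l \<in> spec M")
        case True
        then obtain z where z: "z \<noteq> 0" "M *v z = l *\<^sub>R z"
          by (auto simp: spec_def)
        have "z \<bullet> (M *v y - l *\<^sub>R y) = 0"
          using z(2) by (simp add: inner_diff_right inner_symmetric_matrix[OF sym])
        then have "ones_vec \<bullet> z = 0"
          using y(2) c False by (simp add: inner_commute)
        then show ?thesis
          using z by (auto simp: spec0_iff)
      next
        case nonspec: False
        have "y = R *v ((M - l *\<^sub>R mat 1) *v y)"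
          by (simp add: matrix_vector_mul_assoc R(1)[OF nonspec])
        also have "\<dots> = (c * (ones_vec \<bullet> y)) *\<^sub>R (R *v ones_vec)"
          by (simp only: shift y(2) matrix_vector_mult_scaleR)
        finally have "ones_vec \<bullet> y = (c * (ones_vec \<bullet> y)) * (ones_vec \<bullet> (R *v ones_vec))"
          by (metis inner_scaleR_right)
        then show ?thesis
          using False nonspec by simp
      qed
    qed
  next
    assume "l \<in> spec0 M \<or> (l \<notin> spec M \<and> c * (ones_vec \<bullet> (R *v ones_vec)) = 1)"
    then show "l \<in> spec (M - c *\<^sub>R ones_mat)"
    proof
      assume "l \<in> spec0 M"
      then show ?thesis
        by (auto simp: spec0_iff perturbed)
    next
      assume l: "l \<notin> spec M \<and> c * (ones_vec \<bullet> (R *v ones_vec)) = 1"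
      define y where "y = R *v ones_vec"
      have "M *v y - l *\<^sub>R y = (M - l *\<^sub>R mat 1) *v (R *v ones_vec)"
        by (simp only: shift y_def)
      also have "\<dots> = ones_vec"
        using l by (simp add: matrix_vector_mul_assoc R(2))
      finally have "M *v y - l *\<^sub>R y = (c * (ones_vec \<bullet> y)) *\<^sub>R ones_vec"
        using l by (simp add: y_def)
      moreover have "y \<noteq> 0"
        using l by (auto simp: y_def)
      ultimately show ?thesis
        by (auto simp: perturbed)
    qed
  qed
qed

section \<open>Spectra of regular graphs\<close>

lemma transpose_adj_mat: "simple_graph E \<Longrightarrow> transpose (adj_mat E) = adj_mat E"
  by (auto simp: simple_graph_def symp_def transpose_def adj_mat_def vec_eq_iff)

lemma adj_mat_vector: "(adj_mat E *v x) $ u = (\<Sum>v | E u v. x $ v)"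
proof -
  have "(adj_mat E *v x) $ u = (\<Sum>v\<in>UNIV. if E u v then x $ v else 0)"
    by (auto simp: matrix_vector_mult_def adj_mat_def intro!: sum.cong)
  then show ?thesis
    by (simp add: sum.If_cases)
qed

lemma adj_mat_ones:
  assumes "regular_graph E r"
  shows "adj_mat E *v ones_vec = real r *\<^sub>R ones_vec"
  using assms by (simp add: vec_eq_iff adj_mat_vector regular_graph_def) (simp add: ones_vec_def)

lemma regular_degree_less:
  fixes E :: "'n::finite \<Rightarrow> 'n \<Rightarrow> bool"
  assumes "simple_graph E" "regular_graph E r"
  shows "r < CARD('n)"
proof -
  fix u :: 'n
  have "{v. E u v} \<subset> UNIV"
    using assms(1) by (auto simp: simple_graph_def irreflp_def)
  then have "card {v. E u v} < CARD('n)"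
    by (intro psubset_card_mono) auto
  then show ?thesis
    using assms(2) by (simp add: regular_graph_def)
qed

text \<open>
  Compare both sides of the eigenvalue equation at an entry of largest modulus.
\<close>

lemma regular_eigenvalue_bound:
  fixes E :: "'n::finite \<Rightarrow> 'n \<Rightarrow> bool"
  assumes "regular_graph E r" "l \<in> spec (adj_mat E)"
  shows "\<bar>l\<bar> \<le> real r"
proof -
  obtain x where x: "x \<noteq> 0" "adj_mat E *v x = l *\<^sub>R x"
    using assms(2) by (auto simp: spec_def)
  define N where "N = Max (range (\<lambda>v. \<bar>x $ v\<bar>))"
  have N: "\<bar>x $ v\<bar> \<le> N" for v
    by (simp add: N_def)
  have "N \<in> range (\<lambda>v. \<bar>x $ v\<bar>)"
    unfolding N_def by (intro Max_in) auto
  then obtain u where u: "N = \<bar>x $ u\<bar>"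
    by auto
  obtain w where "x $ w \<noteq> 0"
    using x(1) by (auto simp: vec_eq_iff)
  then have pos: "0 < N"
    using N[of w] by linarith
  have "l * x $ u = (\<Sum>v | E u v. x $ v)"
    by (metis adj_mat_vector x(2) vector_scaleR_component real_scaleR_def)
  then have "\<bar>l\<bar> * N = \<bar>\<Sum>v | E u v. x $ v\<bar>"
    by (metis abs_mult u)
  also have "\<dots> \<le> (\<Sum>v | E u v. N)"
    using N by (intro order.trans[OF sum_abs] sum_mono) auto
  also have "\<dots> = real r * N"
    using assms(1) by (simp add: regular_graph_def)
  finally show ?thesis
    using pos by simp
qed

text \<open>
  The ones vector is an eigenvector for the eigenvalue \<open>r\<close>, and eigenvectors of a symmetric matrix
  for different eigenvalues are orthogonal.
\<close>

lemma spec0_regular: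
  assumes "simple_graph E" "regular_graph E r" "l \<noteq> real r"
  shows "l \<in> spec0 (adj_mat E) \<longleftrightarrow> l \<in> spec (adj_mat E)"
proof
  assume "l \<in> spec (adj_mat E)"
  then obtain x where x: "x \<noteq> 0" "adj_mat E *v x = l *\<^sub>R x"
    by (auto simp: spec_def)
  have "real r * (ones_vec \<bullet> x) = (adj_mat E *v ones_vec) \<bullet> x"
    by (simp add: adj_mat_ones[OF assms(2)])
  also have "\<dots> = l * (ones_vec \<bullet> x)"
    using x(2) inner_symmetric_matrix[OF transpose_adj_mat[OF assms(1)], of ones_vec x] by simp
  finally show "l \<in> spec0 (adj_mat E)"
    using x assms(3) by (auto simp: spec0_iff)
qed (simp add: spec0_def)

section \<open>Adjacency and distances in a join\<close>

lemma simple_graph_join: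
  assumes "simple_graph E1" "simple_graph E2"
  shows "simple_graph (graph_join E1 E2)"
proof -
  have "graph_join E1 E2 v u" if "graph_join E1 E2 u v" for u v
    using that assms by (cases u; cases v) (auto simp: simple_graph_def dest: sympD)
  moreover have "\<not> graph_join E1 E2 u u" for u
    using assms by (cases u) (auto simp: simple_graph_def irreflp_def)
  ultimately show ?thesis
    by (auto simp: simple_graph_def intro!: sympI irreflpI)
qed

lemma graph_dist_self: "graph_dist E u u = 0"
  unfolding graph_dist_def by (intro Least_equality) auto

lemma graph_dist_adjacent:
  assumes "E u v" "u \<noteq> v"
  shows "graph_dist E u v = 1"
  unfolding graph_dist_def
proof (rule Least_equality)
  show "1 \<le> k" if "(E ^^ k) u v" for k
    using that assms(2) by (cases k) auto
qed (use assms(1) in auto)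

lemma graph_dist_common_neighbour:
  assumes "E u w" "E w v" "u \<noteq> v" "\<not> E u v"
  shows "graph_dist E u v = 2"
  unfolding graph_dist_def
proof (rule Least_equality)
  show "(E ^^ 2) u v"
    using assms by (auto simp: numeral_2_eq_2)
  show "2 \<le> k" if "(E ^^ k) u v" for k
  proof (rule ccontr)
    assume "\<not> 2 \<le> k"
    then have "k = 0 \<or> k = 1"
      by linarith
    then show False
      using that assms(3,4) by auto
  qed
qed

lemma join_common_neighbour:
  assumes "\<not> graph_join E1 E2 u v"
  obtains w where "graph_join E1 E2 u w" "graph_join E1 E2 w v"
proof (cases u)
  case (Inl a)
  with assms obtain b where "v = Inl b"
    by (cases v) auto
  with Inl that[of "Inr undefined"] show ?thesis
    by simp
next
  case (Inr a)
  with assms obtain b where "v = Inr b"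
    by (cases v) auto
  with Inr that[of "Inl undefined"] show ?thesis
    by simp
qed

lemma dist_mat_join:
  assumes "simple_graph E1" "simple_graph E2"
  shows "dist_mat (graph_join E1 E2) =
           2 *\<^sub>R ones_mat - 2 *\<^sub>R mat 1 - adj_mat (graph_join E1 E2)"
proof -
  let ?E = "graph_join E1 E2"
  have irrefl: "\<not> ?E u u" for u
    using simple_graph_join[OF assms] by (simp add: simple_graph_def irreflp_def)
  have "real (graph_dist ?E u v) = 2 - 2 * (if u = v then 1 else 0) - (if ?E u v then 1 else 0)"
    for u v
  proof (cases "u = v")
    case True
    then show ?thesis
      by (simp add: graph_dist_self irrefl)
  next
    case False
    show ?thesis
    proof (cases "?E u v")
      case True
      then show ?thesis
        using False by (simp add: graph_dist_adjacent)
    next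
      case nonadj: False
      then obtain w where "?E u w" "?E w v"
        by (rule join_common_neighbour)
      then show ?thesis
        using False nonadj by (simp add: graph_dist_common_neighbour)
    qed
  qed
  then show ?thesis
    by (simp add: vec_eq_iff dist_mat_def ones_mat_def mat_def adj_mat_def)
qed

text \<open>
  The vector with entries \<open>1, -2, 1\<close> along an induced path \<open>u, w, v\<close> has Rayleigh quotient
  \<open>-8/6\<close>. This makes the minimum lie strictly below \<open>-1\<close>, the value for complete graphs.
\<close>

lemma induced_path_rayleigh:
  fixes E :: "'n::finite \<Rightarrow> 'n \<Rightarrow> bool"
  assumes E: "simple_graph E" and adj: "E u w" "E w v" and nonadj: "\<not> E u v" and neq: "u \<noteq> v"
  obtains f where "f \<noteq> 0" "ones_vec \<bullet> f = 0" "f \<bullet> (adj_mat E *v f) < - (f \<bullet> f)"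
proof -
  have rev: "E w u" "E v w" "\<not> E v u" and loop: "\<not> E x x" for x
    using E adj nonadj by (auto simp: simple_graph_def irreflp_def dest: sympD)
  have dist: "u \<noteq> w" "v \<noteq> w"
    using adj loop by auto
  define f :: "real ^ 'n" where "f = axis u 1 + axis v 1 - 2 *\<^sub>R axis w 1"
  have entry: "axis x 1 \<bullet> (adj_mat E *v axis y 1) = (if E x y then 1 else 0)" for x y
    by (simp add: inner_axis' matrix_vector_mult_basis column_def adj_mat_def)
  have "ones_vec \<bullet> f = 0"
    by (simp add: f_def inner_add_right inner_diff_right inner_axis ones_vec_def)
  moreover have "f \<bullet> f = 6"
    using neq dist by (simp add: f_def inner_add inner_diff inner_axis_axis)
  moreover have "f \<bullet> (adj_mat E *v f) = - 8"
    using adj nonadj rev loop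
    by (simp add: f_def inner_add inner_diff matrix_vector_right_distrib
        matrix_vector_mult_diff_distrib matrix_vector_mult_scaleR entry)
  ultimately show ?thesis
    by (intro that[of f]) auto
qed

section \<open>The compressed spectrum of a join\<close>

definition vec_join :: "real ^ 'a \<Rightarrow> real ^ 'b \<Rightarrow> real ^ ('a::finite + 'b::finite)" where
  "vec_join x y = (\<chi> u. case u of Inl a \<Rightarrow> x $ a | Inr b \<Rightarrow> y $ b)"

lemma vec_join_nth [simp]: "vec_join x y $ Inl a = x $ a" "vec_join x y $ Inr b = y $ b"
  by (simp_all add: vec_join_def)

lemma vec_join_cases:
  obtains x y where "f = vec_join x y"
proof
  show "f = vec_join (\<chi> a. f $ Inl a) (\<chi> b. f $ Inr b)"
    by (auto simp: vec_join_def vec_eq_iff split: sum.split)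
qed

lemma vec_join_eq_iff [simp]: "vec_join x y = vec_join x' y' \<longleftrightarrow> x = x' \<and> y = y'"
  by (metis vec_join_nth vec_eq_iff)

lemma vec_join_eq_zero [simp]: "vec_join x y = 0 \<longleftrightarrow> x = 0 \<and> y = 0"
proof -
  have "0 = vec_join 0 (0 :: real ^ _)"
    by (simp add: vec_join_def vec_eq_iff split: sum.split)
  then show ?thesis
    by (metis vec_join_eq_iff)
qed

lemma sum_UNIV_sum_type:
  fixes g :: "'a::finite + 'b::finite \<Rightarrow> real"
  shows "sum g UNIV = (\<Sum>a\<in>UNIV. g (Inl a)) + (\<Sum>b\<in>UNIV. g (Inr b))"
  using sum.Plus[of "UNIV :: 'a set" "UNIV :: 'b set" g] by (simp add: UNIV_Plus_UNIV)

lemma ones_inner_vec_join: "ones_vec \<bullet> vec_join x y = ones_vec \<bullet> x + ones_vec \<bullet> y"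
  by (simp add: inner_vec_def sum_UNIV_sum_type ones_vec_def)

lemma vec_join_scale_add_ones:
  "l *\<^sub>R vec_join x y + \<nu> *\<^sub>R ones_vec =
     vec_join (l *\<^sub>R x + \<nu> *\<^sub>R ones_vec) (l *\<^sub>R y + \<nu> *\<^sub>R ones_vec)"
  by (auto simp: vec_eq_iff vec_join_def ones_vec_def split: sum.split)

lemma adj_mat_join_vector:
  "adj_mat (graph_join E1 E2) *v vec_join x y =
     vec_join (adj_mat E1 *v x + (ones_vec \<bullet> y) *\<^sub>R ones_vec)
              (adj_mat E2 *v y + (ones_vec \<bullet> x) *\<^sub>R ones_vec)"
  by (auto simp: vec_eq_iff vec_join_def adj_mat_def matrix_vector_mult_def sum_UNIV_sum_type
      ones_vec_def inner_vec_def split: sum.split)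

text \<open>
  Let \<open>f\<close> consist of \<open>x\<close> and \<open>y\<close>, and put \<open>t = \<langle>e, y\<rangle> = - \<langle>e, x\<rangle>\<close>. Pairing the first block of
  \<open>A f = l f + \<nu> e\<close> with \<open>e\<close> gives \<open>\<nu> = t + (l - r) t / m\<close>, because \<open>A\<^sub>1 e = r e\<close>. The second
  block becomes \<open>A\<^sub>2 y = l y + c t e\<close>, in which \<open>x\<close> no longer occurs. If \<open>y = 0\<close>, then \<open>x\<close> is
  an eigenvector of \<open>A\<^sub>1\<close> orthogonal to \<open>e\<close>. Conversely, such an \<open>x\<close> extends by zero, and a given
  \<open>y\<close> is completed by the constant vector \<open>x = - (t / m) e\<close>.
\<close>

lemma compressed_spec_join:
  fixes E1 :: "'a::finite \<Rightarrow> 'a \<Rightarrow> bool" and E2 :: "'b::finite \<Rightarrow> 'b \<Rightarrow> bool"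
  assumes E1: "simple_graph E1" "regular_graph E1 r"
  defines "m \<equiv> real CARD('a)"
  shows "l \<in> compressed_spec (adj_mat (graph_join E1 E2)) \<longleftrightarrow>
           l \<in> spec0 (adj_mat E1) \<or>
           l \<in> spec (adj_mat E2 - ((l + 2 * m - real r) / m) *\<^sub>R ones_mat)"
    (is "_ \<longleftrightarrow> _ \<or> l \<in> spec (_ - ?c *\<^sub>R _)")
proof -
  have m: "0 < m"
    by (simp add: m_def)
  have c: "?c = 2 + (l - real r) / m"
    using m by (simp add: field_simps)
  note reg = adj_mat_ones[OF E1(2)]
  note sym = inner_symmetric_matrix[OF transpose_adj_mat[OF E1(1)]]
  have perturbed: "l \<in> spec (adj_mat E2 - ?c *\<^sub>R ones_mat) \<longleftrightarrow>
      (\<exists>y. y \<noteq> 0 \<and> adj_mat E2 *v y = l *\<^sub>R y + (?c * (ones_vec \<bullet> y)) *\<^sub>R ones_vec)"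
    by (simp add: spec_def matrix_vector_mult_diff_rdistrib
        scaleR_matrix_vector_assoc[symmetric] ones_mat_vector diff_eq_eq)
  have join: "l \<in> compressed_spec (adj_mat (graph_join E1 E2)) \<longleftrightarrow>
      (\<exists>x y \<nu>. (x \<noteq> 0 \<or> y \<noteq> 0) \<and> ones_vec \<bullet> x + ones_vec \<bullet> y = 0 \<and>
         adj_mat E1 *v x + (ones_vec \<bullet> y) *\<^sub>R ones_vec = l *\<^sub>R x + \<nu> *\<^sub>R ones_vec \<and>
         adj_mat E2 *v y + (ones_vec \<bullet> x) *\<^sub>R ones_vec = l *\<^sub>R y + \<nu> *\<^sub>R ones_vec)"
    (is "_ \<longleftrightarrow> (\<exists>x y \<nu>. ?stat x y \<nu>)")
  proof
    assume "l \<in> compressed_spec (adj_mat (graph_join E1 E2))"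
    then obtain f \<nu> where f: "f \<noteq> 0" "ones_vec \<bullet> f = 0"
        "adj_mat (graph_join E1 E2) *v f = l *\<^sub>R f + \<nu> *\<^sub>R ones_vec"
      by (auto simp: compressed_spec_def)
    obtain x y where "f = vec_join x y"
      by (rule vec_join_cases)
    with f show "\<exists>x y \<nu>. ?stat x y \<nu>"
      by (auto simp: ones_inner_vec_join adj_mat_join_vector vec_join_scale_add_ones)
  next
    assume "\<exists>x y \<nu>. ?stat x y \<nu>"
    then obtain x y \<nu> where "?stat x y \<nu>"
      by blast
    then show "l \<in> compressed_spec (adj_mat (graph_join E1 E2))"
      unfolding compressed_spec_def
      by (auto simp: ones_inner_vec_join adj_mat_join_vector vec_join_scale_add_ones
          intro!: exI[of _ "vec_join x y"] exI[of _ \<nu>])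
  qed
  show ?thesis
  proof
    assume "l \<in> compressed_spec (adj_mat (graph_join E1 E2))"
    then obtain x y \<nu> where nz: "x \<noteq> 0 \<or> y \<noteq> 0" and zero: "ones_vec \<bullet> x + ones_vec \<bullet> y = 0"
      and eq1: "adj_mat E1 *v x + (ones_vec \<bullet> y) *\<^sub>R ones_vec = l *\<^sub>R x + \<nu> *\<^sub>R ones_vec"
      and eq2: "adj_mat E2 *v y + (ones_vec \<bullet> x) *\<^sub>R ones_vec = l *\<^sub>R y + \<nu> *\<^sub>R ones_vec"
      unfolding join by blast
    define t where "t = ones_vec \<bullet> y"
    have t: "ones_vec \<bullet> x = - t"
      using zero by (simp add: t_def)
    have "ones_vec \<bullet> (adj_mat E1 *v x) + t * m = l * (- t) + \<nu> * m"
      using arg_cong[OF eq1, of "\<lambda>z. ones_vec \<bullet> z"]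
      by (simp add: inner_add_right inner_ones_ones m_def t flip: t_def)
    moreover have "ones_vec \<bullet> (adj_mat E1 *v x) = - real r * t"
      by (simp add: sym reg t)
    ultimately have \<nu>: "\<nu> = t + (l - real r) / m * t"
      using m by (simp add: field_simps)
    have "adj_mat E2 *v y = l *\<^sub>R y + (\<nu> + t) *\<^sub>R ones_vec"
      using eq2 by (simp add: t algebra_simps)
    also have "\<nu> + t = ?c * t"
      by (simp only: \<nu> c) (simp add: algebra_simps)
    finally have y: "adj_mat E2 *v y = l *\<^sub>R y + (?c * (ones_vec \<bullet> y)) *\<^sub>R ones_vec"
      by (simp add: t_def)
    show "l \<in> spec0 (adj_mat E1) \<or> l \<in> spec (adj_mat E2 - ?c *\<^sub>R ones_mat)"
    proof (cases "y = 0")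
      case True
      then have "t = 0"
        by (simp add: t_def)
      then have "adj_mat E1 *v x = l *\<^sub>R x" "ones_vec \<bullet> x = 0"
        using eq1 t \<nu> by (simp_all flip: t_def)
      then show ?thesis
        using nz True by (auto simp: spec0_iff)
    next
      case False
      then show ?thesis
        using y by (auto simp: perturbed)
    qed
  next
    assume "l \<in> spec0 (adj_mat E1) \<or> l \<in> spec (adj_mat E2 - ?c *\<^sub>R ones_mat)"
    then show "l \<in> compressed_spec (adj_mat (graph_join E1 E2))"
    proof
      assume "l \<in> spec0 (adj_mat E1)"
      then obtain x where "x \<noteq> 0" "adj_mat E1 *v x = l *\<^sub>R x" "ones_vec \<bullet> x = 0"
        by (auto simp: spec0_iff)
      then show ?thesis
        unfolding join by (intro exI[of _ x] exI[of _ 0]) simp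
    next
      assume "l \<in> spec (adj_mat E2 - ?c *\<^sub>R ones_mat)"
      then obtain y where y: "y \<noteq> 0"
          "adj_mat E2 *v y = l *\<^sub>R y + (?c * (ones_vec \<bullet> y)) *\<^sub>R ones_vec"
        by (auto simp: perturbed)
      define t where "t = ones_vec \<bullet> y"
      define x :: "real ^ 'a" where "x = (- t / m) *\<^sub>R ones_vec"
      define \<nu> where "\<nu> = t + (l - real r) / m * t"
      have x: "ones_vec \<bullet> x = - t"
        using m by (simp add: x_def inner_ones_ones flip: m_def)
      have "adj_mat E1 *v x = (real r * (- t / m)) *\<^sub>R ones_vec"
        by (simp only: x_def matrix_vector_mult_scaleR reg scaleR_scaleR mult.commute)
      moreover have "real r * (- t / m) + t = l * (- t / m) + \<nu>"
        using m by (simp add: \<nu>_def field_simps)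
      ultimately have eq1: "adj_mat E1 *v x + t *\<^sub>R ones_vec = l *\<^sub>R x + \<nu> *\<^sub>R ones_vec"
        by (metis x_def scaleR_add_left scaleR_scaleR)
      have "?c * t + (- t) = \<nu>"
        by (simp only: \<nu>_def c) (simp add: algebra_simps)
      then have eq2: "adj_mat E2 *v y + (- t) *\<^sub>R ones_vec = l *\<^sub>R y + \<nu> *\<^sub>R ones_vec"
        unfolding y(2) t_def[symmetric] by (metis add.assoc scaleR_add_left)
      show ?thesis
        unfolding join
        by (intro exI[of _ x] exI[of _ y] exI[of _ \<nu>])
          (simp only: x flip: t_def, use y(1) eq1 eq2 in simp)
    qed
  qed
qed

section \<open>The quadratic embedding constant of a join\<close>

theorem theorem1p1:
  fixes E1 :: "'a::finite \<Rightarrow> 'a \<Rightarrow> bool" and E2 :: "'b::finite \<Rightarrow> 'b \<Rightarrow> bool" and r :: nat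
  assumes "simple_graph E1" and "simple_graph E2"
    and "\<not> complete_graph (graph_join E1 E2)"
    and "regular_graph E1 r"
  shows "let m = real CARD('a);
             \<Lambda>1 = {real r - m} \<inter> (spec (adj_mat E1) \<union> spec (adj_mat E2 - ones_mat));
             \<Lambda>2 = {real r - 2 * m} \<inter> spec (adj_mat E2);
             \<Lambda>3 = (spec0 (adj_mat E1) \<union> spec0 (adj_mat E2)) - {real r - m, real r - 2 * m};
             \<Lambda>4 = {l. l \<notin> {real r - m, real r - 2 * m} \<union> spec (adj_mat E1) \<union> spec (adj_mat E2) \<and>
                      m = (l + 2 * m - real r) *
                            (ones_vec \<bullet> (matrix_inv (adj_mat E2 - l *\<^sub>R mat 1) *v ones_vec))}
         in QEC (graph_join E1 E2) =
              - 2 - (LEAST l. l \<in> (\<Union>\<Lambda>\<in>{\<Lambda>1, \<Lambda>2, \<Lambda>3, \<Lambda>4}. \<Lambda> \<inter> {..< -1}))"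
proof -
  let ?E = "graph_join E1 E2"
  let ?R = "\<lambda>l. ones_vec \<bullet> (matrix_inv (adj_mat E2 - l *\<^sub>R mat 1) *v ones_vec)"
  define m where "m = real CARD('a)"
  define \<Lambda>1 where "\<Lambda>1 = {real r - m} \<inter> (spec (adj_mat E1) \<union> spec (adj_mat E2 - ones_mat))"
  define \<Lambda>2 where "\<Lambda>2 = {real r - 2 * m} \<inter> spec (adj_mat E2)"
  define \<Lambda>3 where
    "\<Lambda>3 = (spec0 (adj_mat E1) \<union> spec0 (adj_mat E2)) - {real r - m, real r - 2 * m}"
  define \<Lambda>4 where
    "\<Lambda>4 = {l. l \<notin> {real r - m, real r - 2 * m} \<union> spec (adj_mat E1) \<union> spec (adj_mat E2) \<and>
              m = (l + 2 * m - real r) * ?R l}"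
  define \<mu> where "\<mu> = - 2 - QEC ?E"
  have m: "0 < m" "real r < m"
    using regular_degree_less[OF assms(1,4)] by (simp_all add: m_def)
  have join: "simple_graph ?E"
    using assms(1,2) by (rule simple_graph_join)
  have card: "CARD('a + 'b) \<ge> 2"
  proof -
    have "0 < CARD('a)" "0 < CARD('b)"
      by simp_all
    then show ?thesis
      unfolding card_UNIV_sum by (simp del: zero_less_card_finite)
  qed
  note qec = QEC_diameter_two[OF card transpose_adj_mat[OF join] dist_mat_join[OF assms(1,2)],
      folded \<mu>_def]

  have "\<mu> < -1"
  proof -
    obtain u v where uv: "u \<noteq> v" "\<not> ?E u v"
      using assms(3) by (auto simp: complete_graph_def)
    then obtain w where "?E u w" "?E w v"
      using join_common_neighbour by blast
    then obtain f where f: "f \<noteq> 0" "ones_vec \<bullet> f = 0" "f \<bullet> (adj_mat ?E *v f) < - (f \<bullet> f)"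
      using induced_path_rayleigh[OF join] uv by blast
    have "\<mu> * (f \<bullet> f) < (- 1) * (f \<bullet> f)"
      using qec(2)[OF f(2)] f(3) by linarith
    then show ?thesis
      by (rule mult_right_less_imp_less) simp
  qed

  \<comment> \<open>Below \<open>-1\<close> the eigenvalue \<open>r\<close> of the constant vector cannot occur, so \<open>\<sigma>\<close> and \<open>\<sigma>\<^sub>0\<close> agree for
     the regular graph.\<close>
  have mem: "l \<in> compressed_spec (adj_mat ?E) \<longleftrightarrow> l \<in> \<Lambda>1 \<union> \<Lambda>2 \<union> \<Lambda>3 \<union> \<Lambda>4" if "l < -1" for l
  proof -
    define c where "c = (l + 2 * m - real r) / m"
    have iff: "l \<in> compressed_spec (adj_mat ?E) \<longleftrightarrow>
        l \<in> spec0 (adj_mat E1) \<or> l \<in> spec (adj_mat E2 - c *\<^sub>R ones_mat)"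
      unfolding c_def m_def by (rule compressed_spec_join[OF assms(1,4)])
    have spec0: "l \<in> spec0 (adj_mat E1) \<longleftrightarrow> l \<in> spec (adj_mat E1)"
      using that by (intro spec0_regular[OF assms(1,4)]) auto
    consider "l = real r - m" | "l = real r - 2 * m" | "l \<noteq> real r - m" "l \<noteq> real r - 2 * m"
      by blast
    then show ?thesis
    proof cases
      case 1
      then have "c = 1"
        using m by (simp add: c_def)
      then show ?thesis
        unfolding iff spec0 using 1 m by (auto simp: \<Lambda>1_def \<Lambda>2_def \<Lambda>3_def \<Lambda>4_def)
    next
      case 2
      then have "c = 0"
        by (simp add: c_def)
      \<comment> \<open>Since \<open>r < m\<close>, the number \<open>r - 2 * m\<close> lies below \<open>- r\<close>.\<close>
      moreover have "l \<notin> spec (adj_mat E1)"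
        using regular_eigenvalue_bound[OF assms(4), of l] 2 m by auto
      ultimately show ?thesis
        unfolding iff spec0 using 2 m by (auto simp: \<Lambda>1_def \<Lambda>2_def \<Lambda>3_def \<Lambda>4_def)
    next
      case 3
      then have "c \<noteq> 0"
        using m by (simp add: c_def)
      note pert = spec_rank_one_perturbation[OF transpose_adj_mat[OF assms(2)] this, of l]
      have "c * ?R l = 1 \<longleftrightarrow> m = (l + 2 * m - real r) * ?R l"
        using m by (auto simp: c_def field_simps)
      then show ?thesis
        unfolding iff pert using 3 spec0 by (auto simp: \<Lambda>1_def \<Lambda>2_def \<Lambda>3_def \<Lambda>4_def)
    qed
  qed

  have "(LEAST l. l \<in> (\<Union>\<Lambda>\<in>{\<Lambda>1, \<Lambda>2, \<Lambda>3, \<Lambda>4}. \<Lambda> \<inter> {..< -1})) = \<mu>"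
  proof (rule Least_equality)
    show "\<mu> \<in> (\<Union>\<Lambda>\<in>{\<Lambda>1, \<Lambda>2, \<Lambda>3, \<Lambda>4}. \<Lambda> \<inter> {..< -1})"
      using qec(1) mem[OF \<open>\<mu> < -1\<close>] \<open>\<mu> < -1\<close> by auto
    show "\<mu> \<le> l" if "l \<in> (\<Union>\<Lambda>\<in>{\<Lambda>1, \<Lambda>2, \<Lambda>3, \<Lambda>4}. \<Lambda> \<inter> {..< -1})" for l
      using that mem[of l] by (intro qec(3)) auto
  qed
  then have "QEC ?E = - 2 - (LEAST l. l \<in> (\<Union>\<Lambda>\<in>{\<Lambda>1, \<Lambda>2, \<Lambda>3, \<Lambda>4}. \<Lambda> \<inter> {..< -1}))"
    by (simp add: \<mu>_def)
  then show ?thesis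
    unfolding Let_def \<Lambda>1_def \<Lambda>2_def \<Lambda>3_def \<Lambda>4_def m_def .
qed

end
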